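(* Let $k$ be a positive integer. For every integer $n\ge 1$, $$M_{n+1}^{(k)}=\det(V_n),$$ where $V_n$ is the $n\times n$ tridiagonal matrix $$V_n=\begin{bmatrix} M_{2}^{(k)} & M_{1}^{(k)} & & & & \\ 2^k & 2^{k}+1 & 1 & & & \\ & 2^k & 2^{k}+1 & 1 & & \\ & & \ddots & \ddots & \ddots & \\ & & & 2^k & 2^{k}+1 & 1 \\ & & & & 2^k & 2^{k}+1 \end{bmatrix}_{n\times n}.$$
   Context: The Mersenne numbers $\{M_n\}_{n\ge 0}$ are defined by $M_0=0$, $M_1=1$, $M_{n+2}=3M_{n+1}-2M_n$, i.e. $M_n=2^n-1$. For a positive integer $k$, the higher order Mersenne numbers are $M_n^{(k)}=M_{kn}/M_k$ for $n=0,1,2,\dots$. The entries of $V_n$ are: $(1,1)$ entry $M_2^{(k)}$; $(1,2)$ entry $M_1^{(k)}$ (when $n\ge2$); $(i,i)$ entry $2^k+1$ for $2\le i\le n$; $(i,i+1)$ entry $1$ for $2\le i\le n-1$; $(i+1,i)$ entry $2^k$ for $1\le i\le n-1$; all other entries $0$. In particular $V_1=[M_2^{(k)}]$. *)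

theory Defs
  imports Complex_Main "Jordan_Normal_Form.Determinant"
begin

fun mersenne :: "nat \<Rightarrow> int" where
  "mersenne 0 = 0"
| "mersenne (Suc 0) = 1"
| "mersenne (Suc (Suc n)) = 3 * mersenne (Suc n) - 2 * mersenne n"

definition mersenne_higher :: "nat \<Rightarrow> nat \<Rightarrow> rat" where
  "mersenne_higher k n = of_int (mersenne (k * n)) / of_int (mersenne k)"

(* Indices of mat start at 0, so entry (i, j) here is the usual entry (i + 1, j + 1). *)
definition V_mat :: "nat \<Rightarrow> nat \<Rightarrow> rat mat" where
  "V_mat k n = mat n n (\<lambda>(i, j).
     if i = 0 \<and> j = 0 then mersenne_higher k 2
     else if i = 0 \<and> j = 1 then mersenne_higher k 1
     else if i = j then 2 ^ k + 1
     else if j = i + 1 then 1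
     else if i = j + 1 then 2 ^ k
     else 0)"

end

theory Submission imports Defs
begin

text \<open>Put q = 2^k. Then M_n^(k) = 1 + q + ... + q^(n-1), so the first row of V_n fits the pattern of the
  others and V_n is a tridiagonal Toeplitz matrix. Both sides of the claim satisfy
  x(n+2) = (q + 1) x(n+1) - q x(n) with the same initial values.\<close>

lemma mersenne_eq: "mersenne n = 2 ^ n - 1"
  by (induction n rule: mersenne.induct) auto

text \<open>At \<open>k = 0\<close> both sides are 0, since division by 0 gives 0.\<close>

lemma mersenne_higher_eq: "mersenne_higher k n = ((2 ^ k) ^ n - 1) / (2 ^ k - 1)"
  by (simp add: mersenne_higher_def mersenne_eq power_mult)

definition tridiag_toeplitz :: "'a \<Rightarrow> 'a \<Rightarrow> 'a \<Rightarrow> nat \<Rightarrow> 'a :: comm_ring_1 mat" where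
  "tridiag_toeplitz a b c n = mat n n (\<lambda>(i, j).
     if i = j then a else if j = i + 1 then b else if i = j + 1 then c else 0)"

lemma tridiag_toeplitz_carrier [simp]: "tridiag_toeplitz a b c n \<in> carrier_mat n n"
  by (simp add: tridiag_toeplitz_def)

lemma det_tridiag_toeplitz_0: "det (tridiag_toeplitz a b c 0) = 1"
  by (rule det_dim_zero) simp

lemma det_tridiag_toeplitz_1: "det (tridiag_toeplitz a b c (Suc 0)) = a"
  using det_single[of "tridiag_toeplitz a b c (Suc 0)"] by (simp add: tridiag_toeplitz_def)

text \<open>Laplace expansion along the first column leaves two minors: one is the Toeplitz matrix
  of the next smaller size, the other reduces to the one below it by expansion along its first
  row.\<close>

lemma det_tridiag_toeplitz_Suc_Suc:
  "det (tridiag_toeplitz a b c (Suc (Suc n))) =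
     a * det (tridiag_toeplitz a b c (Suc n)) - b * c * det (tridiag_toeplitz a b c n)"
proof -
  let ?T = "tridiag_toeplitz a b c"
  let ?A = "?T (Suc (Suc n))"
  \<comment> \<open>The minor belonging to the entry \<open>c\<close>; its first row is
    \<open>b\<close> followed by zeros.\<close>
  let ?B = "mat_delete ?A (Suc 0) 0"
  have B: "?B \<in> carrier_mat (Suc n) (Suc n)"
    by (simp add: tridiag_toeplitz_def mat_delete_def)
  have del_A: "mat_delete ?A 0 0 = ?T (Suc n)"
    by (rule eq_matI) (auto simp: tridiag_toeplitz_def mat_delete_def)
  have del_B: "mat_delete ?B 0 0 = ?T n"
    by (rule eq_matI) (auto simp: tridiag_toeplitz_def mat_delete_def)
  have B_row: "?B $$ (0, j) = (if j = 0 then b else 0)" if "j < Suc n" for j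
    using that by (auto simp: tridiag_toeplitz_def mat_delete_def)
  have "det ?B = (\<Sum>j<Suc n. ?B $$ (0, j) * cofactor ?B 0 j)"
    by (rule laplace_expansion_row[OF B]) simp
  also have "\<dots> = b * det (?T n)"
    by (subst sum.lessThan_Suc_shift) (simp add: B_row cofactor_def del_B)
  finally have det_B: "det ?B = b * det (?T n)" .
  have A_col: "?A $$ (i, 0) = (if i = 0 then a else if i = 1 then c else 0)"
    if "i < Suc (Suc n)" for i
    using that by (auto simp: tridiag_toeplitz_def)
  have "det ?A = (\<Sum>i<Suc (Suc n). ?A $$ (i, 0) * cofactor ?A i 0)"
    by (rule laplace_expansion_column) simp_all
  also have "\<dots> = a * det (?T (Suc n)) - c * det ?B"
    \<comment> \<open>Two shifts split off the only nonzero entries of the column, at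
      \<open>i = 0\<close> and \<open>i = 1\<close>; the cofactor at \<open>i = 1\<close> brings the
      minus sign.\<close>
    by (subst sum.lessThan_Suc_shift, subst sum.lessThan_Suc_shift)
       (simp add: A_col cofactor_def del_A)
  finally show ?thesis
    by (simp add: det_B)
qed

text \<open>The factor \<open>q - 1\<close> replaces a division, so the closed form of the geometric
  sum makes sense in any commutative ring.\<close>

lemma det_tridiag_toeplitz_geometric:
  "(q - 1) * det (tridiag_toeplitz (q + 1) 1 q n) = q ^ (n + 1) - 1"
proof (induction n rule: induct_nat_012)
  case (ge2 n)
  have "(q - 1) * det (tridiag_toeplitz (q + 1) 1 q (Suc (Suc n))) =
      (q + 1) * ((q - 1) * det (tridiag_toeplitz (q + 1) 1 q (Suc n)))
      - q * ((q - 1) * det (tridiag_toeplitz (q + 1) 1 q n))"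
    by (simp add: det_tridiag_toeplitz_Suc_Suc algebra_simps)
  also have "\<dots> = q ^ (Suc (Suc n) + 1) - 1"
    \<comment> \<open>The terms \<open>q ^ (n + 2)\<close> and \<open>q\<close> cancel.\<close>
    unfolding ge2 by (simp add: algebra_simps)
  finally show ?case .
qed (simp_all add: det_tridiag_toeplitz_0 det_tridiag_toeplitz_1 algebra_simps)

theorem theorem3p3:
  fixes k n :: nat
  assumes "k \<ge> 1" and "n \<ge> 1"
  shows "mersenne_higher k (n + 1) = det (V_mat k n)"
proof -
  define q :: rat where "q = 2 ^ k"
  \<comment> \<open>This is where \<open>k \<ge> 1\<close> enters: \<open>q - 1\<close> is nonzero,
    so it can be divided out.\<close>
  have "q > 1"
    using assms(1) by (simp add: q_def)
  \<comment> \<open>These values turn the two special entries of the first row into the Toeplitz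
    entries \<open>1\<close> and \<open>q + 1\<close>.\<close>
  then have M: "mersenne_higher k (Suc 0) = 1" "mersenne_higher k 2 = q + 1"
    by (simp_all add: mersenne_higher_eq flip: q_def) (simp add: field_simps power2_eq_square)
  have "V_mat k n = tridiag_toeplitz (q + 1) 1 q n"
    by (rule eq_matI) (auto simp: V_mat_def tridiag_toeplitz_def M simp flip: q_def)
  then show ?thesis
    using det_tridiag_toeplitz_geometric[of q n] \<open>q > 1\<close>
    by (simp add: mersenne_higher_eq field_simps flip: q_def)
qed

end
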